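(* Let $\mathbb{K}$ be a field and let $C \in (\mathbb{K}^{m})^{\otimes k}$ be a symmetrically concise tensor. Let $\mathrm{Stab}_{\mathbb{K}}(C)$ be its stabilizer under the congruence action by $\mathrm{GL}(m,\mathbb{K})$. Then for any matrix $X \in \mathbb{K}^{d\times m}$ of rank $m \le d$, $$\bigl\{ Y \in \mathbb{K}^{d\times m} : [\![C;X,X,\ldots,X]\!] = [\![C;Y,Y,\ldots,Y]\!] \bigr\} = \bigl\{ XZ : Z \in \mathrm{Stab}_{\mathbb{K}}(C)\bigr\}.$$
   Context: For a tensor $C=(c_{\alpha_1\ldots\alpha_k}) \in (\mathbb{K}^m)^{\otimes k}$ and a matrix $X=(x_{ij}) \in \mathbb{K}^{d\times m}$, the tensor $[\![C;X,\ldots,X]\!] \in (\mathbb{K}^d)^{\otimes k}$ has entries $$[\![C;X,\ldots,X]\!]_{\beta_1\ldots\beta_k} = \sum_{\alpha_1,\ldots,\alpha_k=1}^m c_{\alpha_1\ldots\alpha_k}\, x_{\beta_1\alpha_1}\cdots x_{\beta_k\alpha_k}.$$ For $d=m$ and $X$ invertible this is the congruence action, and $\mathrm{Stab}_{\mathbb{K}}(C) = \{Z \in \mathrm{GL}(m,\mathbb{K}) : [\![C;Z,\ldots,Z]\!] = C\}$. A tensor $C\in(\mathbb{K}^m)^{\otimes k}$ is symmetrically concise if there is no proper linear subspace $W\subsetneq\mathbb{K}^m$ with $C\in W^{\otimes k}$. (In the paper $\mathbb{K}$ is usually $\mathbb{R}$ or $\mathbb{C}$.) *)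

theory Defs
  imports "HOL-Analysis.Cartesian_Space"
begin

text \<open>
  An element of \<open>(K\<^sup>m)\<^sup>\<otimes>\<^sup>k\<close> is represented by its array of entries.  The finite types \<open>'m\<close> and \<open>'k\<close>
  have \<open>m\<close> and \<open>k\<close> elements; a multi-index is a function \<open>'k \<Rightarrow> 'm\<close>.
\<close>

type_synonym ('a, 'm, 'k) tensor = "('a, 'k \<Rightarrow> 'm) vec"

definition pure_tensor ::
  "('k::finite \<Rightarrow> 'a::field ^ 'm::finite) \<Rightarrow> ('a, 'm, 'k) tensor" where
  "pure_tensor w = (\<chi> \<alpha>. \<Prod>i\<in>UNIV. w i $ \<alpha> i)"

text \<open>\<open>W\<^sup>\<otimes>\<^sup>k\<close> as a subspace of \<open>(K\<^sup>m)\<^sup>\<otimes>\<^sup>k\<close>.\<close>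

definition tensor_power ::
  "('a::field ^ 'm::finite) set \<Rightarrow> ('a, 'm, 'k::finite) tensor set" where
  "tensor_power W = vec.span {pure_tensor w | w. \<forall>i. w i \<in> W}"

definition symmetrically_concise ::
  "('a::field, 'm::finite, 'k::finite) tensor \<Rightarrow> bool" where
  "symmetrically_concise C \<longleftrightarrow>
     (\<nexists>W. vec.subspace W \<and> W \<noteq> UNIV \<and> C \<in> tensor_power W)"

text \<open>The tensor \<open>[[C; X, \<dots>, X]]\<close>; here \<open>X\<close> has \<open>d\<close> rows and \<open>m\<close> columns.\<close>

definition tensor_congruence ::
  "('a::field, 'm::finite, 'k::finite) tensor \<Rightarrow> 'a ^ 'm ^ 'd::finite \<Rightarrow> ('a, 'd, 'k) tensor" where
  "tensor_congruence C X = (\<chi> \<beta>. \<Sum>\<alpha>\<in>UNIV. C $ \<alpha> * (\<Prod>i\<in>UNIV. X $ \<beta> i $ \<alpha> i))"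

definition Stab ::
  "('a::field, 'm::finite, 'k::finite) tensor \<Rightarrow> ('a ^ 'm ^ 'm) set" where
  "Stab C = {Z. invertible Z \<and> tensor_congruence C Z = C}"

end

theory Submission
  imports Defs
begin

text \<open>
  Suppose \<open>[[C; X, \<dots>, X]] = [[C; Y, \<dots>, Y]]\<close>.  For every left inverse \<open>L\<close> of \<open>X\<close>, the matrix
  \<open>L Y\<close> fixes \<open>C\<close>; hence \<open>C\<close> lies in the tensor power of the column space of \<open>L Y\<close>, and conciseness
  makes \<open>L Y\<close> invertible.  If some \<open>Y v\<close> were outside the column space of \<open>X\<close>, then a left inverse of
  \<open>X\<close> could be chosen to kill \<open>Y v\<close>, contradicting this invertibility.  So the columns of \<open>Y\<close> lie in
  the column space of \<open>X\<close>, on which \<open>X L\<close> is the identity, and \<open>Y = X (L Y)\<close>.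
\<close>

text \<open>Expanding the product over \<open>i\<close> of the sums over \<open>j\<close> chooses
  one \<open>j\<close> per position. These choices are the multi-indices \<open>\<gamma>\<close> of
  the intermediate tensor.\<close>

lemma tensor_congruence_mult:
  fixes C :: "('a::field, 'm::finite, 'k::finite) tensor"
    and Z :: "'a ^ 'm ^ 'n::finite" and X :: "'a ^ 'n ^ 'd::finite"
  shows "tensor_congruence C (X ** Z) = tensor_congruence (tensor_congruence C Z) X"
proof -
  have "(\<Sum>\<alpha>\<in>UNIV. C $ \<alpha> * (\<Prod>i\<in>UNIV. \<Sum>j\<in>UNIV. X $ \<beta> i $ j * Z $ j $ \<alpha> i)) =
      (\<Sum>\<gamma>\<in>UNIV. (\<Sum>\<alpha>\<in>UNIV. C $ \<alpha> * (\<Prod>i\<in>UNIV. Z $ \<gamma> i $ \<alpha> i)) * (\<Prod>i\<in>UNIV. X $ \<beta> i $ \<gamma> i))"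
    for \<beta> :: "'k \<Rightarrow> 'd"
  proof -
    have "(\<Prod>i\<in>UNIV. \<Sum>j\<in>UNIV. X $ \<beta> i $ j * Z $ j $ \<alpha> i) =
        (\<Sum>\<gamma>\<in>UNIV. (\<Prod>i\<in>UNIV. X $ \<beta> i $ \<gamma> i) * (\<Prod>i\<in>UNIV. Z $ \<gamma> i $ \<alpha> i))"
      for \<alpha> :: "'k \<Rightarrow> 'm"
      using prod_sum_PiE[of "UNIV :: 'k set" "\<lambda>_. UNIV :: 'n set"
          "\<lambda>i j. X $ \<beta> i $ j * Z $ j $ \<alpha> i"]
      by (simp add: prod.distrib)
    then have "(\<Sum>\<alpha>\<in>UNIV. C $ \<alpha> * (\<Prod>i\<in>UNIV. \<Sum>j\<in>UNIV. X $ \<beta> i $ j * Z $ j $ \<alpha> i)) =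
        (\<Sum>\<alpha>\<in>UNIV. \<Sum>\<gamma>\<in>UNIV.
          C $ \<alpha> * ((\<Prod>i\<in>UNIV. X $ \<beta> i $ \<gamma> i) * (\<Prod>i\<in>UNIV. Z $ \<gamma> i $ \<alpha> i)))"
      by (simp add: sum_distrib_left)
    also have "\<dots> = (\<Sum>\<gamma>\<in>UNIV. \<Sum>\<alpha>\<in>UNIV.
          C $ \<alpha> * ((\<Prod>i\<in>UNIV. X $ \<beta> i $ \<gamma> i) * (\<Prod>i\<in>UNIV. Z $ \<gamma> i $ \<alpha> i)))"
      by (rule sum.swap)
    finally show ?thesis
      by (simp add: sum_distrib_left sum_distrib_right mult_ac)
  qed
  then show ?thesis
    by (simp add: tensor_congruence_def matrix_matrix_mult_def vec_eq_iff)
qed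

lemma tensor_congruence_mat_1:
  fixes C :: "('a::field, 'm::finite, 'k::finite) tensor"
  shows "tensor_congruence C (mat 1) = C"
proof -
  \<comment> \<open>A product of Kronecker deltas over all positions is the delta of the
    multi-indices.\<close>
  have "(\<Prod>i\<in>UNIV. if \<beta> i = \<alpha> i then 1 else 0) = (if \<alpha> = \<beta> then 1 else (0::'a))"
    for \<alpha> \<beta> :: "'k \<Rightarrow> 'm"
    by (cases "\<alpha> = \<beta>") (auto simp: fun_eq_iff eq_commute[of "\<beta> _"])
  then show ?thesis
    by (simp add: tensor_congruence_def mat_def vec_eq_iff if_distrib[of "\<lambda>x. _ * x"] cong: if_cong)
qed

text \<open>The entries of \<open>C\<close> are the coefficients of an expansion into pure tensors
  of columns of \<open>Y\<close>.\<close>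

lemma tensor_congruence_in_tensor_power:
  fixes C :: "('a::field, 'm::finite, 'k::finite) tensor"
    and Y :: "'a ^ 'm ^ 'd::finite"
  shows "tensor_congruence C Y \<in> tensor_power (range ((*v) Y))"
proof -
  have "tensor_congruence C Y = (\<Sum>\<alpha>\<in>UNIV. C $ \<alpha> *s pure_tensor (\<lambda>i. column (\<alpha> i) Y))"
    by (simp add: tensor_congruence_def pure_tensor_def column_def vec_eq_iff)
  moreover have "column j Y \<in> range ((*v) Y)" for j
  proof
    show "column j Y = Y *v axis j 1"
      by (simp add: column_def matrix_vector_mult_def axis_def vec_eq_iff
          if_distrib[of "\<lambda>x. _ * x"] cong: if_cong)
  qed simp
  ultimately show ?thesis
    unfolding tensor_power_def
    by (simp only:) (intro vec.span_sum vec.span_scale vec.span_base, blast)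
qed

lemma symmetrically_concise_congruence_invertible:
  fixes C :: "('a::field, 'm::finite, 'k::finite) tensor"
    and Z :: "'a ^ 'm ^ 'm"
  assumes "symmetrically_concise C" and "tensor_congruence C Z = C"
  shows "invertible Z"
proof -
  have "vec.subspace (range ((*v) Z))"
    by (simp add: vec.subspace_image)
  moreover have "C \<in> tensor_power (range ((*v) Z))"
    using tensor_congruence_in_tensor_power[of C Z] assms(2) by simp
  ultimately have "surj ((*v) Z)"
    using assms(1) unfolding symmetrically_concise_def by blast
  then show ?thesis
    by (simp add: invertible_right_inverse matrix_right_invertible_surjective)
qed

text \<open>\<open>rank\<close> is the dimension of the row span, so full rank makes the rows span
  the whole space.\<close>

lemma full_rank_left_inverse:
  fixes X :: "'a::field ^ 'm::finite ^ 'd::finite"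
  assumes "rank X = CARD('m)"
  shows "\<exists>L. L ** X = mat 1"
proof -
  have "vec.span (rows X) = UNIV"
    using assms vec.dim_eq_full[of "rows X"] by (simp add: row_rank_def_gen vec.dimension_def card_cart_basis)
  then show ?thesis
    by (simp add: matrix_left_invertible_span_rows_gen)
qed

lemma matrix_vector_transitive:
  fixes u :: "'a::field ^ 'd::finite" and w :: "'a ^ 'm::finite"
  assumes "u \<noteq> 0"
  shows "\<exists>A. A *v u = w"
proof -
  obtain p where p: "u $ p \<noteq> 0"
    using assms by (auto simp: vec_eq_iff)
  \<comment> \<open>Only column \<open>p\<close> is nonzero: it is \<open>w\<close> scaled to
    compensate for the entry \<open>u $ p\<close>.\<close>
  have "(\<chi> i j. if j = p then w $ i / u $ p else 0) *v u = w"
    using p by (simp add: vec_eq_iff matrix_vector_mult_def if_distrib[of "\<lambda>x. x * _"] cong: if_cong)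
  then show ?thesis by blast
qed

lemma left_inverse_annihilating:
  fixes X :: "'a::field ^ 'm::finite ^ 'd::finite"
  assumes "L ** X = mat 1" and "y \<notin> range ((*v) X)"
  shows "\<exists>L'. L' ** X = mat 1 \<and> L' *v y = 0"
proof -
  \<comment> \<open>This residual is what \<open>1 - X L\<close> makes of \<open>y\<close>; sending
    it to \<open>- (L *v y)\<close> cancels \<open>L *v y\<close>.\<close>
  have "y - X *v (L *v y) \<noteq> 0"
    using assms(2) by auto
  then obtain A where A: "A *v (y - X *v (L *v y)) = - (L *v y)"
    using matrix_vector_transitive by blast
  \<comment> \<open>Adding a multiple of \<open>1 - X L\<close>, which annihilates \<open>X\<close>, keeps \<open>L\<close> a left inverse.\<close>
  let ?L = "L + (A - A ** (X ** L))"
  have "?L *v y = 0"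
    using A by (simp add: algebra_simps matrix_vector_mul_assoc)
  moreover have "?L ** X = mat 1"
  proof -
    have "?L *v (X *v v) = mat 1 *v v" for v
      using assms(1)
      by (simp add: algebra_simps flip: matrix_vector_mul_assoc)
        (simp add: matrix_vector_mul_assoc)
    then show ?thesis
      by (simp add: matrix_eq matrix_vector_mul_assoc)
  qed
  ultimately show ?thesis by blast
qed

theorem theorem4p2:
  fixes C :: "('a::field, 'm::finite, 'k::finite) tensor"
    and X :: "'a ^ 'm ^ 'd::finite"
  assumes "symmetrically_concise C"
    and "rank X = CARD('m)"
    and "CARD('m) \<le> CARD('d)"
  shows "{Y :: 'a ^ 'm ^ 'd. tensor_congruence C X = tensor_congruence C Y} =
         {X ** Z | Z. Z \<in> Stab C}"
proof safe
  fix Y :: "'a ^ 'm ^ 'd"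
  assume Y: "tensor_congruence C X = tensor_congruence C Y"
  have stab: "L ** Y \<in> Stab C" if "L ** X = mat 1" for L :: "'a ^ 'd ^ 'm"
  proof -
    \<comment> \<open>Applying \<open>L\<close> to both sides of \<open>Y\<close> turns the side of
      \<open>X\<close> into the congruence by \<open>L ** X = mat 1\<close>.\<close>
    have "tensor_congruence C (L ** Y) = C"
      using Y that by (metis tensor_congruence_mult tensor_congruence_mat_1)
    then show ?thesis
      using assms(1) by (simp add: Stab_def symmetrically_concise_congruence_invertible)
  qed
  obtain L where L: "L ** X = mat 1"
    using assms(2) full_rank_left_inverse by blast
  have Y_range: "Y *v v \<in> range ((*v) X)" for v
  proof (rule ccontr)
    assume notin: "Y *v v \<notin> range ((*v) X)"
    then obtain L' where L': "L' ** X = mat 1" "L' *v (Y *v v) = 0"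
      using left_inverse_annihilating[OF L] by blast
    then have "invertible (L' ** Y)" and "(L' ** Y) *v v = 0"
      using stab by (auto simp: Stab_def matrix_vector_mul_assoc)
    then have "v = 0"
      by (metis invertible_left_inverse matrix_left_invertible_ker)
    \<comment> \<open>For \<open>v = 0\<close>, the vector \<open>Y *v v\<close> is zero and so lies
      in the range of \<open>X\<close>.\<close>
    with notin show False
      by (metis matrix_vector_mult_0_right rangeI)
  qed
  have "X *v (L *v y) = y" if "y \<in> range ((*v) X)" for y
    using that L by (metis imageE matrix_vector_mul_assoc matrix_vector_mul_lid)
  with Y_range have "Y = X ** (L ** Y)"
    by (simp add: matrix_eq flip: matrix_vector_mul_assoc)
  then show "\<exists>Z. Y = X ** Z \<and> Z \<in> Stab C"
    using stab[OF L] by blast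
next
  fix Z
  assume "Z \<in> Stab C"
  then show "tensor_congruence C X = tensor_congruence C (X ** Z)"
    by (simp add: Stab_def tensor_congruence_mult)
qed

end
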